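(* Let $p^*$ be a KKT point of the central NLP for which Assumption 1 and Assumption 2 (both stated in the context) hold, and let $J(p):=\nabla\Phi(p)$ denote the Jacobian of the local solution mapping $\Phi$ near $p^*$. Then there exists a constant $r>0$ such that if $p^0\in\mathcal B_r(p^* )$ and $\|J(p^* )\|<1$, the sequence $\{p^q\}$ generated by the SBDP algorithm (Algorithm 1, or Algorithm 2 when the NLP is neighbor-affine) converges to the central KKT point $p^*$. Moreover, for all $q=1,2,\dots$ the following holds: (i) The order of convergence is at least linear, i.e., there exists a constant $C\in(0,1)$ (independent of $q$) such that $\|p^q-p^*\|\le C\,\|p^{q-1}-p^*\|$. (ii) If $\|J(p^* )\|=0$, then the order of convergence is quadratic, i.e., there exists a constant $\tilde C<\infty$ (independent of $q$) such that $\|p^q-p^*\|\le \tilde C\,\|p^{q-1}-p^*\|^2$.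
   Context: **Central NLP.** Let $\mathcal G=(\mathcal V,\mathcal E)$ be a connected undirected graph with $\mathcal V=\{1,\dots,M\}$ and neighbor sets $\mathcal N_i=\{j\in\mathcal V: (i,j)\in\mathcal E,\ j\ne i\}$. Agent $i$ has the decision variable $x_i\in\mathbb R^{n_i}$; write $x_{\mathcal N_i}=[x_j]_{j\in\mathcal N_i}$ (stacked). The central NLP is $$\min_{x_1,\dots,x_M}\ \sum_{i\in\mathcal V} f_i(x_i,x_{\mathcal N_i})\quad\text{s.t. } g_i(x_i,x_{\mathcal N_i})=0,\quad h_i(x_i,x_{\mathcal N_i})\le 0,\quad i\in\mathcal V,$$ with $f_i$ real-valued, $g_i$ being $\mathbb R^{n_{gi}}$-valued and $h_i$ being $\mathbb R^{n_{hi}}$-valued; all functions are at least three times continuously differentiable. Put $L_i(x_i,\lambda_i,\mu_i,x_{\mathcal N_i})=f_i+\lambda_i^\top g_i+\mu_i^\top h_i$, $L=\sum_{i} L_i$, $x=[x_i]_i$, $\lambda=[\lambda_i]_i$, $\mu=[\mu_i]_i$, $g(x)=[g_i]_{i}$, $h(x)=[h_i]_{i}$, $p_i=[x_i^\top,\lambda_i^\top,\mu_i^\top]^\top$, and $p=[p_i]_{i\in\mathcal V}\in\mathbb R^{p}$ (the symbol $p$ also denotes the dimension). Let $U_i=\mathrm{diag}(\mu_i)$. Jacobians are matrices whose rows are transposed gradients; $\|\cdot\|$ is the Euclidean/spectral norm; $\mathcal B_r(p^* )$ is the open ball of radius $r$ around $p^*$. **Central KKT conditions:** $\nabla_{x_i}L(x,\lambda,\mu)=0$,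 $g_i=0$, $U_ih_i=0$, $h_i\le0$, $\mu_i\ge0$ for all $i\in\mathcal V$. **Local NLPs.** Given $\bar p=[\bar p_i]_i$, agent $i$ solves $$\min_{x_i}\ f_i(x_i,\bar x_{\mathcal N_i})+\sum_{j\in\mathcal N_i}\big(\nabla_{x_i}L_j(\bar x_j,\bar\lambda_j,\bar\mu_j,\bar x_{\mathcal N_j})\big)^\top(x_i-\bar x_i)\ \text{ s.t. } g_i(x_i,\bar x_{\mathcal N_i})=0,\ h_i(x_i,\bar x_{\mathcal N_i})\le0 .$$ Its KKT conditions for all agents together are $\hat F(p,\bar p)=0$ together with $h_i(x_i,\bar x_{\mathcal N_i})\le 0$, $\mu_i\ge0$ for all $i$, where $$\hat F(p,\bar p)=\begin{bmatrix}\nabla_{x_i}L_i(x_i,\lambda_i,\mu_i,\bar x_{\mathcal N_i})+\sum_{j\in\mathcal N_i}\nabla_{x_i}L_j(\bar x_j,\bar\lambda_j,\bar\mu_j,\bar x_{\mathcal N_j})\\ g_i(x_i,\bar x_{\mathcal N_i})\\ U_ih_i(x_i,\bar x_{\mathcal N_i})\end{bmatrix}_{i\in\mathcal V}.$$ **Assumption 1.** The central NLP has a KKT point $p^*$ such that (i) strict complementary slackness holds: $[\mu^*]_k>0$ whenever $[h(x^* )]_k=0$; (ii) the second-order sufficient condition (SOSC) holds: $s^\top\nabla^2_{xx}L(x^*,\lambda^*,\mu^* )s>0$ for all $s\ne0$ with $\nabla_xg(x^* )s=0$ and $[\nabla_xh(x^* )]_{\mathcal A(x^* )}s=0$, where $\mathcal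 A(x)=\{k:[h(x)]_k=0\}$ and $[\cdot]_{\mathcal A}$ selects rows; (iii) LICQ holds: the columns of $[\nabla_xg(x^* )^\top,[\nabla_xh(x^* )]_{\mathcal A(x^* )}^\top]$ are linearly independent. **Assumption 2.** For every $i\in\mathcal V$, with $\mathcal A_i=\{k:[h_i(x_i^*,x^*_{\mathcal N_i})]_k=0\}$: (i) $s_i^\top\nabla^2_{x_ix_i}L_i(x_i^*,\lambda_i^*,\mu_i^*,x^*_{\mathcal N_i})s_i>0$ for all $s_i\ne0$ with $\nabla_{x_i}g_i(x_i^*,x_{\mathcal N_i}^* )s_i=0$ and $[\nabla_{x_i}h_i(x_i^*,x_{\mathcal N_i}^* )]_{\mathcal A_i}s_i=0$; (ii) the columns of $[\nabla_{x_i}g_i(x_i^*,x_{\mathcal N_i}^* )^\top,[\nabla_{x_i}h_i(x_i^*,x_{\mathcal N_i}^* )]_{\mathcal A_i}^\top]$ are linearly independent. **Solution mapping and algorithm.** Under Assumptions 1 and 2, near $p^*$ there is a single-valued $C^1$ mapping $\Phi$ with $\Phi(p^* )=p^*$ such that for $\bar p$ near $p^*$, $\Phi(\bar p)$ is the locally unique (near $p^*$) solution of the concatenated local KKT systems with parameter $\bar p$, i.e. $\hat F(\Phi(\bar p),\bar p)=0$ and the inequalities hold. One iteration of the SBDP algorithm consists of all agents solving in parallel their local NLPs with parameter $\bar p=p^{q-1}$, giving $p^q=\Phi(p^{q-1})$, started at $p^0$. Algorithm 1 applies to the general NLP. Algorithm 2 applies when the NLP is neighbor-affine (every $f_i,g_i,h_i$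 has the form $k_i(x_i,x_{\mathcal N_i})=k_{ii}(x_i)+\sum_{j\in\mathcal N_i}k_{ij}(x_i,x_j)$). The two algorithms differ only in which agent computes the gradients $\nabla_{x_i}L_j$ and what is communicated, so both perform the recursion $p^q=\Phi(p^{q-1})$. *)

theory Defs
  imports "HOL-Analysis.Analysis"
begin

section \<open>Gradients, Hessians and smoothness on Euclidean space\<close>

definition partial :: "'n::finite \<Rightarrow> (real^'n \<Rightarrow> real) \<Rightarrow> real^'n \<Rightarrow> real" where
  "partial k F x = frechet_derivative F (at x) (axis k 1)"

definition grad :: "(real^'n::finite \<Rightarrow> real) \<Rightarrow> real^'n \<Rightarrow> real^'n" where
  "grad F x = (\<chi> k. partial k F x)"

definition hess :: "(real^'n::finite \<Rightarrow> real) \<Rightarrow> real^'n \<Rightarrow> real^'n^'n" where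
  "hess F x = jacobian (grad F) (at x)"

primrec times_cont_diff :: "nat \<Rightarrow> (real^'n::finite \<Rightarrow> real) \<Rightarrow> bool" where
  "times_cont_diff 0 F \<longleftrightarrow> continuous_on UNIV F"
| "times_cont_diff (Suc m) F \<longleftrightarrow>
     (\<forall>x. F differentiable (at x)) \<and> (\<forall>k. times_cont_diff m (partial k F))"

definition depends_only_on :: "'n::finite set \<Rightarrow> (real^'n \<Rightarrow> real) \<Rightarrow> bool" where
  "depends_only_on S F \<longleftrightarrow> (\<forall>x y. (\<forall>k\<in>S. x $ k = y $ k) \<longrightarrow> F x = F y)"

definition lin_indep_family :: "'c set \<Rightarrow> ('c \<Rightarrow> 'b::real_vector) \<Rightarrow> bool" where
  "lin_indep_family S v \<longleftrightarrow> inj_on v S \<and> independent (v ` S)"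


section \<open>The central problem\<close>

text \<open>
  Agents are the elements of the finite type \<open>'v\<close>. The stacked decision vector \<open>x\<close> lies in
  \<open>real^'n\<close> and the stacked primal-dual vector \<open>p\<close> in \<open>real^'p\<close>. Each coordinate of \<open>p\<close> is
  either a decision coordinate (the image of some \<open>k :: 'n\<close> under \<open>xpos\<close>), or the multiplier of a
  scalar equality constraint (an element of \<open>eqs\<close>), or the multiplier of a scalar inequality
  constraint (an element of \<open>ineqs\<close>); constraints are named by the position of their multiplier.
  The map \<open>owner\<close> tells to which agent a coordinate belongs, so \<open>n_i\<close>, \<open>n_gi\<close> and \<open>n_hi\<close> are the
  numbers of coordinates of each kind owned by agent \<open>i\<close>. Using one index type for all of \<open>p\<close>,
  rather than one type per kind, admits problems without equality or without inequality
  constraints, since type variables cannot be instantiated by an empty type.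
\<close>

record ('v, 'n, 'p) nlp =
  edges :: "('v \<times> 'v) set"
  xpos  :: "'n \<Rightarrow> 'p"
  eqs   :: "'p set"
  ineqs :: "'p set"
  owner :: "'p \<Rightarrow> 'v"
  fobj  :: "'v \<Rightarrow> real^'n \<Rightarrow> real"
  gcon  :: "'p \<Rightarrow> real^'n \<Rightarrow> real"
  hcon  :: "'p \<Rightarrow> real^'n \<Rightarrow> real"

definition nbrs :: "('v, 'n::finite, 'p) nlp \<Rightarrow> 'v \<Rightarrow> 'v set" where
  "nbrs P i = {j. (i, j) \<in> edges P \<and> j \<noteq> i}"

definition xcoords :: "('v, 'n::finite, 'p) nlp \<Rightarrow> 'v set \<Rightarrow> 'n set" where
  "xcoords P I = {k. owner P (xpos P k) \<in> I}"

definition eqs_of :: "('v, 'n::finite, 'p) nlp \<Rightarrow> 'v \<Rightarrow> 'p set" where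
  "eqs_of P i = {c \<in> eqs P. owner P c = i}"

definition ineqs_of :: "('v, 'n::finite, 'p) nlp \<Rightarrow> 'v \<Rightarrow> 'p set" where
  "ineqs_of P i = {c \<in> ineqs P. owner P c = i}"

text \<open>
  The functions of agent \<open>i\<close> are written as functions of the whole of \<open>x\<close> that depend only on
  the blocks \<open>x_i\<close> and \<open>x_j\<close>, \<open>j \<in> nbrs P i\<close>.
\<close>

definition central_nlp :: "('v::finite, 'n::finite, 'p::finite) nlp \<Rightarrow> bool" where
  "central_nlp P \<longleftrightarrow>
     sym (edges P) \<and> (\<forall>i j. (i, j) \<in> (edges P)\<^sup>*) \<and>
     inj (xpos P) \<and> range (xpos P) \<union> eqs P \<union> ineqs P = UNIV \<and>
     range (xpos P) \<inter> eqs P = {} \<and> range (xpos P) \<inter> ineqs P = {} \<and> eqs P \<inter> ineqs P = {} \<and>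
     (\<forall>i. times_cont_diff 3 (fobj P i) \<and>
          depends_only_on (xcoords P (insert i (nbrs P i))) (fobj P i)) \<and>
     (\<forall>c\<in>eqs P. times_cont_diff 3 (gcon P c) \<and>
          depends_only_on (xcoords P (insert (owner P c) (nbrs P (owner P c)))) (gcon P c)) \<and>
     (\<forall>c\<in>ineqs P. times_cont_diff 3 (hcon P c) \<and>
          depends_only_on (xcoords P (insert (owner P c) (nbrs P (owner P c)))) (hcon P c))"

definition xpart :: "('v, 'n::finite, 'p::finite) nlp \<Rightarrow> real^'p \<Rightarrow> real^'n" where
  "xpart P p = (\<chi> k. p $ xpos P k)"

text \<open>In the Lagrangians, \<open>p\<close> only supplies the multipliers; the point is the last argument.\<close>

definition agent_lagrangian ::
  "('v::finite, 'n::finite, 'p::finite) nlp \<Rightarrow> 'v \<Rightarrow> real^'p \<Rightarrow> real^'n \<Rightarrow> real" where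
  "agent_lagrangian P i p x =
     fobj P i x + (\<Sum>c\<in>eqs_of P i. p $ c * gcon P c x) + (\<Sum>c\<in>ineqs_of P i. p $ c * hcon P c x)"

definition lagrangian ::
  "('v::finite, 'n::finite, 'p::finite) nlp \<Rightarrow> real^'p \<Rightarrow> real^'n \<Rightarrow> real" where
  "lagrangian P p x = (\<Sum>i\<in>UNIV. agent_lagrangian P i p x)"

definition central_kkt_point :: "('v::finite, 'n::finite, 'p::finite) nlp \<Rightarrow> real^'p \<Rightarrow> bool" where
  "central_kkt_point P p \<longleftrightarrow>
     grad (lagrangian P p) (xpart P p) = 0 \<and>
     (\<forall>c\<in>eqs P. gcon P c (xpart P p) = 0) \<and>
     (\<forall>c\<in>ineqs P. p $ c * hcon P c (xpart P p) = 0 \<and> hcon P c (xpart P p) \<le> 0 \<and> p $ c \<ge> 0)"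


section \<open>Regularity of the central and the local problems\<close>

definition active :: "('v, 'n::finite, 'p::finite) nlp \<Rightarrow> real^'n \<Rightarrow> 'p set" where
  "active P x = {c \<in> ineqs P. hcon P c x = 0}"

definition con_grad :: "('v, 'n::finite, 'p::finite) nlp \<Rightarrow> real^'n \<Rightarrow> 'p \<Rightarrow> real^'n" where
  "con_grad P x c = (if c \<in> eqs P then grad (gcon P c) x else grad (hcon P c) x)"

definition strict_complementarity :: "('v, 'n::finite, 'p::finite) nlp \<Rightarrow> real^'p \<Rightarrow> bool" where
  "strict_complementarity P p \<longleftrightarrow> (\<forall>c\<in>active P (xpart P p). p $ c > 0)"

definition sosc :: "('v::finite, 'n::finite, 'p::finite) nlp \<Rightarrow> real^'p \<Rightarrow> bool" where
  "sosc P p \<longleftrightarrow>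
     (\<forall>s. s \<noteq> 0 \<and> (\<forall>c\<in>eqs P \<union> active P (xpart P p). con_grad P (xpart P p) c \<bullet> s = 0) \<longrightarrow>
          s \<bullet> (hess (lagrangian P p) (xpart P p) *v s) > 0)"

definition licq :: "('v, 'n::finite, 'p::finite) nlp \<Rightarrow> real^'p \<Rightarrow> bool" where
  "licq P p \<longleftrightarrow> lin_indep_family (eqs P \<union> active P (xpart P p)) (con_grad P (xpart P p))"

definition assumption1 :: "('v::finite, 'n::finite, 'p::finite) nlp \<Rightarrow> real^'p \<Rightarrow> bool" where
  "assumption1 P p \<longleftrightarrow>
     central_kkt_point P p \<and> strict_complementarity P p \<and> sosc P p \<and> licq P p"

text \<open>
  A vector \<open>s_i\<close> of agent \<open>i\<close> is a vector of \<open>real^'n\<close> that vanishes outside the coordinates of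
  agent \<open>i\<close>. On such vectors the quadratic form of the full Hessian of \<open>L_i\<close> is the one of its
  \<open>(x_i, x_i)\<close> block, and the inner product with a full gradient is the one with the gradient
  with respect to \<open>x_i\<close>.
\<close>

definition block :: "('v, 'n::finite, 'p) nlp \<Rightarrow> 'v \<Rightarrow> real^'n \<Rightarrow> real^'n" where
  "block P i v = (\<chi> k. if k \<in> xcoords P {i} then v $ k else 0)"

definition agent_active :: "('v, 'n::finite, 'p::finite) nlp \<Rightarrow> 'v \<Rightarrow> real^'n \<Rightarrow> 'p set" where
  "agent_active P i x = {c \<in> ineqs_of P i. hcon P c x = 0}"

definition local_sosc :: "('v::finite, 'n::finite, 'p::finite) nlp \<Rightarrow> 'v \<Rightarrow> real^'p \<Rightarrow> bool" where
  "local_sosc P i p \<longleftrightarrow>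
     (\<forall>s. s \<noteq> 0 \<and> block P i s = s \<and>
          (\<forall>c\<in>eqs_of P i \<union> agent_active P i (xpart P p). con_grad P (xpart P p) c \<bullet> s = 0) \<longrightarrow>
          s \<bullet> (hess (agent_lagrangian P i p) (xpart P p) *v s) > 0)"

definition local_licq :: "('v, 'n::finite, 'p::finite) nlp \<Rightarrow> 'v \<Rightarrow> real^'p \<Rightarrow> bool" where
  "local_licq P i p \<longleftrightarrow>
     lin_indep_family (eqs_of P i \<union> agent_active P i (xpart P p))
       (\<lambda>c. block P i (con_grad P (xpart P p) c))"

definition assumption2 :: "('v::finite, 'n::finite, 'p::finite) nlp \<Rightarrow> real^'p \<Rightarrow> bool" where
  "assumption2 P p \<longleftrightarrow> (\<forall>i. local_sosc P i p \<and> local_licq P i p)"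


section \<open>The concatenated local KKT systems and their solution mapping\<close>

text \<open>The point \<open>(x_i, xb_j for j \<noteq> i)\<close>.\<close>

definition mix :: "('v, 'n::finite, 'p) nlp \<Rightarrow> 'v \<Rightarrow> real^'n \<Rightarrow> real^'n \<Rightarrow> real^'n" where
  "mix P i x xb = (\<chi> k. if k \<in> xcoords P {i} then x $ k else xb $ k)"

definition Fhat ::
  "('v::finite, 'n::finite, 'p::finite) nlp \<Rightarrow> real^'p \<Rightarrow> real^'p \<Rightarrow> real^'p" where
  "Fhat P p pb =
     (\<chi> c. let i = owner P c; z = mix P i (xpart P p) (xpart P pb) in
        if c \<in> eqs P then gcon P c z
        else if c \<in> ineqs P then p $ c * hcon P c z
        else let k = inv (xpos P) c in
          partial k (agent_lagrangian P i p) z +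
          (\<Sum>j\<in>nbrs P i. partial k (agent_lagrangian P j pb) (xpart P pb)))"

definition local_kkt ::
  "('v::finite, 'n::finite, 'p::finite) nlp \<Rightarrow> real^'p \<Rightarrow> real^'p \<Rightarrow> bool" where
  "local_kkt P p pb \<longleftrightarrow>
     Fhat P p pb = 0 \<and>
     (\<forall>c\<in>ineqs P. hcon P c (mix P (owner P c) (xpart P p) (xpart P pb)) \<le> 0 \<and> p $ c \<ge> 0)"

definition solution_mapping ::
  "('v::finite, 'n::finite, 'p::finite) nlp \<Rightarrow> real^'p \<Rightarrow> (real^'p \<Rightarrow> real^'p) \<Rightarrow> bool" where
  "solution_mapping P ps \<Phi> \<longleftrightarrow>
     \<Phi> ps = ps \<and>
     (\<exists>U V. open U \<and> ps \<in> U \<and> open V \<and> ps \<in> V \<and>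
        (\<forall>pb\<in>U. \<Phi> differentiable (at pb)) \<and> continuous_on U (\<lambda>pb. jacobian \<Phi> (at pb)) \<and>
        (\<forall>pb\<in>U. \<Phi> pb \<in> V \<and> local_kkt P (\<Phi> pb) pb \<and>
                 (\<forall>p\<in>V. local_kkt P p pb \<longrightarrow> p = \<Phi> pb)))"


section \<open>The algorithms\<close>

definition nbr_affine_fun ::
  "('v, 'n::finite, 'p) nlp \<Rightarrow> 'v \<Rightarrow> (real^'n \<Rightarrow> real) \<Rightarrow> bool" where
  "nbr_affine_fun P i F \<longleftrightarrow>
     (\<exists>k0 k1. depends_only_on (xcoords P {i}) k0 \<and>
        (\<forall>j\<in>nbrs P i. depends_only_on (xcoords P {i, j}) (k1 j)) \<and>
        (\<forall>x. F x = k0 x + (\<Sum>j\<in>nbrs P i. k1 j x)))"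

definition neighbor_affine :: "('v, 'n::finite, 'p) nlp \<Rightarrow> bool" where
  "neighbor_affine P \<longleftrightarrow>
     (\<forall>i. nbr_affine_fun P i (fobj P i)) \<and>
     (\<forall>c\<in>eqs P. nbr_affine_fun P (owner P c) (gcon P c)) \<and>
     (\<forall>c\<in>ineqs P. nbr_affine_fun P (owner P c) (hcon P c))"

text \<open>
  The two algorithms differ in which agent evaluates the gradients of the neighbors' Lagrangians
  and in what is communicated, not in the iterates; the second one is only available for
  neighbor-affine problems.
\<close>

datatype sbdp_variant = Algorithm1 | Algorithm2

definition sbdp_applicable :: "sbdp_variant \<Rightarrow> ('v, 'n::finite, 'p) nlp \<Rightarrow> bool" where
  "sbdp_applicable a P \<longleftrightarrow> (a = Algorithm2 \<longrightarrow> neighbor_affine P)"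

definition sbdp_sequence ::
  "sbdp_variant \<Rightarrow> ('v, 'n::finite, 'p::finite) nlp \<Rightarrow> (real^'p \<Rightarrow> real^'p) \<Rightarrow> real^'p \<Rightarrow>
   (nat \<Rightarrow> real^'p) \<Rightarrow> bool" where
  "sbdp_sequence a P \<Phi> p0 pq \<longleftrightarrow>
     sbdp_applicable a P \<and> pq 0 = p0 \<and> (\<forall>q\<ge>1. pq q = \<Phi> (pq (q - 1)))"

end

theory Submission
  imports Defs
begin

text \<open>
  The map \<open>Fhat P\<close> is twice continuously differentiable in both arguments jointly. Its partial
  derivative in \<open>p\<close> at \<open>(ps, ps)\<close> decouples over the agents into KKT matrices, which are injective
  by the second-order condition, LICQ and strict complementarity of the local problems. The implicit
  function theorem then yields \<open>\<Phi>\<close>, and linear convergence is a contraction argument. If the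
  Jacobian of \<open>\<Phi>\<close> vanishes at \<open>ps\<close>, so does the partial derivative of \<open>Fhat P\<close> in the parameter;
  the second-order remainder of \<open>Fhat P (\<Phi> p) p = 0\<close> at \<open>(ps, ps)\<close> then bounds \<open>\<Phi> p - ps\<close>
  quadratically, so that \<open>\<Phi>\<close> itself need not be twice differentiable.
\<close>

section \<open>Functions of class \<open>C\<^sup>m\<close>\<close>

text \<open>The derivative is evaluated in fixed directions, so that the recursion stays within one
  type of functions. On finite-dimensional domains this is the usual class C^m.\<close>

primrec ck :: "nat \<Rightarrow> ('a::real_normed_vector \<Rightarrow> 'b::real_normed_vector) \<Rightarrow> bool" where
  "ck 0 f \<longleftrightarrow> continuous_on UNIV f"
| "ck (Suc m) f \<longleftrightarrow>
     (\<exists>f'. (\<forall>x. (f has_derivative f' x) (at x)) \<and> (\<forall>v. ck m (\<lambda>x. f' x v)))"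

lemma ck_SucI:
  "(\<And>x. (f has_derivative f' x) (at x)) \<Longrightarrow> (\<And>v. ck m (\<lambda>x. f' x v)) \<Longrightarrow> ck (Suc m) f"
  by auto

lemma ck_const: "ck m (\<lambda>x. c)"
  by (induction m arbitrary: c) (auto intro!: ck_SucI[unfolded ck.simps(2)] derivative_eq_intros exI[of _ "\<lambda>_ _. 0"])

lemma ck_bounded_linear: "bounded_linear f \<Longrightarrow> ck m f"
  by (cases m) (auto intro!: linear_continuous_on ck_const exI[of _ "\<lambda>_. f"] bounded_linear_imp_has_derivative)

lemma ck_add: "ck m f \<Longrightarrow> ck m g \<Longrightarrow> ck m (\<lambda>x. f x + g x)"
proof (induction m arbitrary: f g)
  case (Suc m)
  then obtain f' g' where "\<And>x. (f has_derivative f' x) (at x)" "\<And>v. ck m (\<lambda>x. f' x v)"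
    "\<And>x. (g has_derivative g' x) (at x)" "\<And>v. ck m (\<lambda>x. g' x v)" by auto
  then show ?case
    by (intro ck_SucI[where f' = "\<lambda>x v. f' x v + g' x v"] has_derivative_add Suc.IH) auto
qed (auto intro: continuous_on_add)

lemma ck_sum: "(\<And>i. i \<in> I \<Longrightarrow> ck m (f i)) \<Longrightarrow> ck m (\<lambda>x. \<Sum>i\<in>I. f i x)"
  by (induction I rule: infinite_finite_induct) (auto intro: ck_const ck_add)

lemma ck_Suc_imp: "ck (Suc m) f \<Longrightarrow> ck m f"
proof (induction m arbitrary: f)
  case 0
  then obtain f' where "\<And>x. (f has_derivative f' x) (at x)" by auto
  then show ?case
    by (auto intro!: continuous_at_imp_continuous_on intro: has_derivative_continuous)
next
  case (Suc m)
  then obtain f' where f: "\<And>x. (f has_derivative f' x) (at x)" "\<And>v. ck (Suc m) (\<lambda>x. f' x v)"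
    by (metis ck.simps(2))
  then show ?case by (intro ck_SucI[of f f'] Suc.IH) auto
qed

lemma ck_mult:
  fixes f g :: "'a::real_normed_vector \<Rightarrow> real"
  shows "ck m f \<Longrightarrow> ck m g \<Longrightarrow> ck m (\<lambda>x. f x * g x)"
proof (induction m arbitrary: f g)
  case (Suc m)
  then obtain f' g' where "\<And>x. (f has_derivative f' x) (at x)" "\<And>v. ck m (\<lambda>x. f' x v)"
    "\<And>x. (g has_derivative g' x) (at x)" "\<And>v. ck m (\<lambda>x. g' x v)" by auto
  moreover have "ck m f" "ck m g" using Suc.prems ck_Suc_imp by auto
  ultimately show ?case
    by (intro ck_SucI[where f' = "\<lambda>x v. f x * g' x v + f' x v * g x"] has_derivative_mult ck_add Suc.IH)
      auto
qed (auto intro: continuous_on_mult)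

text \<open>The inner maps in \<open>Fhat\<close> are linear (\<open>mix\<close>,
  \<open>xpart\<close>, projections). For a fixed direction \<open>v\<close>, the derivative
  \<open>f' (L x) (L v)\<close> is again a function of class C^m composed with \<open>L\<close>,
  which closes the induction.\<close>

lemma ck_compose_linear: "bounded_linear L \<Longrightarrow> ck m f \<Longrightarrow> ck m (\<lambda>x. f (L x))"
proof (induction m arbitrary: f)
  case 0
  then show ?case by (auto intro: continuous_on_compose2 linear_continuous_on)
next
  case (Suc m)
  then obtain f' where f: "\<And>x. (f has_derivative f' x) (at x)" "\<And>v. ck m (\<lambda>x. f' x v)"
    by auto
  have "((\<lambda>x. f (L x)) has_derivative (\<lambda>v. f' (L x) (L v))) (at x)" for x
    using has_derivative_compose[OF bounded_linear_imp_has_derivative[OF Suc.prems(1)] f(1)] .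
  then show ?case using f(2) Suc by (intro ck_SucI) auto
qed

lemma has_derivative_vec:
  fixes f :: "'n::finite \<Rightarrow> 'a::real_normed_vector \<Rightarrow> real"
  assumes "\<And>k. (f k has_derivative f' k) F"
  shows "((\<lambda>x. \<chi> k. f k x) has_derivative (\<lambda>v. \<chi> k. f' k v)) F"
proof -
  have "(\<lambda>x. \<chi> k. f k x) = (\<lambda>x. \<Sum>k\<in>UNIV. f k x *\<^sub>R axis k 1)"
    "(\<lambda>v. \<chi> k. f' k v) = (\<lambda>v. \<Sum>k\<in>UNIV. f' k v *\<^sub>R axis k 1)"
    by (simp_all add: fun_eq_iff vec_eq_iff axis_def if_distrib[of "(*) _"] cong: if_cong)
  then show ?thesis
    using assms by (auto intro!: has_derivative_sum has_derivative_scaleR_left)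
qed

lemma ck_vec:
  fixes f :: "'a::real_normed_vector \<Rightarrow> real^'n::finite"
  shows "(\<And>k. ck m (\<lambda>x. f x $ k)) \<Longrightarrow> ck m f"
proof (induction m arbitrary: f)
  case 0
  then show ?case using continuous_on_vec_lambda[of UNIV "\<lambda>k x. f x $ k"] by simp
next
  case (Suc m)
  then obtain f' where f: "\<And>k x. ((\<lambda>x. f x $ k) has_derivative f' k x) (at x)"
    "\<And>k v. ck m (\<lambda>x. f' k x v)"
    by (simp, metis)
  have "(f has_derivative (\<lambda>v. \<chi> k. f' k x v)) (at x)" for x
    using has_derivative_vec[of "\<lambda>k x. f x $ k" "\<lambda>k. f' k x"] f(1) by simp
  then show ?case using f(2) by (intro ck_SucI Suc.IH) auto
qed

lemma frechet_derivative_partial: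
  assumes "F differentiable (at x)"
  shows "frechet_derivative F (at x) v = (\<Sum>k\<in>UNIV. v $ k * partial k F x)"
proof -
  have l: "linear (frechet_derivative F (at x))"
    using assms by (rule linear_frechet_derivative)
  have "frechet_derivative F (at x) (\<Sum>k\<in>UNIV. v $ k *\<^sub>R axis k 1) =
      (\<Sum>k\<in>UNIV. v $ k * partial k F x)"
    by (simp add: linear_sum[OF l] linear_cmul[OF l] partial_def)
  then show ?thesis using basis_expansion[of v] by (simp add: scalar_mult_eq_scaleR)
qed

text \<open>The derivative in a fixed direction is a linear combination of the partial derivatives
  with constant coefficients, so the smoothness of the partials passes to it.\<close>

lemma ck_if_times_cont_diff: "times_cont_diff m F \<Longrightarrow> ck m F"
proof (induction m arbitrary: F)
  case (Suc m)
  then have d: "F differentiable (at x)" for x by simp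
  show ?case
  proof (rule ck_SucI)
    show "(F has_derivative frechet_derivative F (at x)) (at x)" for x
      using d frechet_derivative_works by blast
    show "ck m (\<lambda>x. frechet_derivative F (at x) v)" for v
      unfolding frechet_derivative_partial[OF d]
      using Suc by (intro ck_sum ck_mult ck_const) auto
  qed
qed simp

text \<open>Differentiability of the derivative at \<open>a\<close> gives
  \<open>onorm (D x - D a) \<le> K * norm (x - a)\<close> near \<open>a\<close>; the mean value
  inequality along the segment from \<open>a\<close> to \<open>x\<close> contributes the second
  factor \<open>norm (x - a)\<close>.\<close>

lemma ck_quadratic_remainder:
  fixes f :: "'a::euclidean_space \<Rightarrow> 'b::real_normed_vector"
  assumes "ck 2 f" and f': "(f has_derivative f') (at a)"
  obtains K e where "e > 0" "\<And>x. x \<in> ball a e \<Longrightarrow> norm (f x - f a - f' (x - a)) \<le> K * (norm (x - a))\<^sup>2"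
proof -
  obtain D where D: "\<And>x. (f has_derivative D x) (at x)" "\<And>v. ck 1 (\<lambda>x. D x v)"
    using assms(1) by (auto simp: numeral_2_eq_2)
  have Da: "D a = f'" using has_derivative_unique[OF D(1) f'] .
  obtain DD where DD: "\<And>v. ((\<lambda>x. D x v) has_derivative DD v) (at a)"
  proof -
    have "\<exists>D'. ((\<lambda>x. D x v) has_derivative D') (at a)" for v
      using D(2)[of v] by auto
    then show ?thesis using that by metis
  qed
  \<comment> \<open>One basis direction at a time: a bound on \<open>DD b\<close> plus the tolerance
    1 in the definition of the derivative gives the Lipschitz constant.\<close>
  have "\<exists>B. \<forall>\<^sub>F x in nhds a. norm (D x b - D a b) \<le> B * norm (x - a)" for b
  proof -
    obtain B where B: "\<And>x. norm (DD b x) \<le> norm x * B"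
      using bounded_linear.bounded[OF has_derivative_bounded_linear[OF DD]] by blast
    obtain d where d: "d > 0"
      "\<And>x. norm (x - a) < d \<Longrightarrow> norm (D x b - D a b - DD b (x - a)) \<le> 1 * norm (x - a)"
      using DD[of b] unfolding has_derivative_at_alt by (meson zero_less_one)
    have "norm (D x b - D a b) \<le> (B + 1) * norm (x - a)" if "dist x a < d" for x
    proof -
      have "norm (D x b - D a b) \<le> norm (D x b - D a b - DD b (x - a)) + norm (DD b (x - a))"
        using norm_triangle_sub[of "D x b - D a b" "DD b (x - a)"] by (simp add: add.commute)
      also have "\<dots> \<le> 1 * norm (x - a) + norm (x - a) * B"
        using d(2)[of x] that B by (intro add_mono) (auto simp: dist_norm)
      finally show ?thesis by (simp add: algebra_simps)
    qed
    then show ?thesis using d(1) by (auto simp: eventually_nhds_metric)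
  qed
  then obtain B where "\<And>b. \<forall>\<^sub>F x in nhds a. norm (D x b - D a b) \<le> B b * norm (x - a)"
    by metis
  then have "\<forall>\<^sub>F x in nhds a. \<forall>b\<in>Basis. norm (D x b - D a b) \<le> B b * norm (x - a)"
    by (intro eventually_ball_finite) auto
  then obtain e where e: "e > 0"
    "\<And>x b. dist x a < e \<Longrightarrow> b \<in> Basis \<Longrightarrow> norm (D x b - D a b) \<le> B b * norm (x - a)"
    by (auto simp: eventually_nhds_metric)
  define K where "K = (\<Sum>b\<in>Basis. \<bar>B b\<bar>)"
  have bl: "bounded_linear (D x)" for x using D(1) by (rule has_derivative_bounded_linear)
  have K: "onorm (\<lambda>v. D x v - D a v) \<le> K * norm (x - a)" if "dist x a < e" for x
  proof -
    have "onorm (\<lambda>v. D x v - D a v) \<le> (\<Sum>b\<in>Basis. norm (D x b - D a b))"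
      by (intro onorm_componentwise bounded_linear_sub bl)
    also have "\<dots> \<le> (\<Sum>b\<in>Basis. \<bar>B b\<bar> * norm (x - a))"
      by (intro sum_mono order_trans[OF e(2)[OF that]] mult_right_mono) auto
    finally show ?thesis by (simp add: K_def sum_distrib_right)
  qed
  show thesis
  proof
    fix x assume x: "x \<in> ball a e"
    have "norm (f x - f a - D a (x - a)) \<le> norm (x - a) * (K * norm (x - a))"
    \<comment> \<open>The radius \<open>norm (x - a)\<close> makes the bound
      \<open>K * norm (y - a)\<close> uniform over the ball.\<close>
    proof (rule differentiable_bound_linearization[where S = "cball a (norm (x - a))"])
      show "a + t *\<^sub>R (x - a) \<in> cball a (norm (x - a))" if "t \<in> {0..1}" for t
        using that by (auto simp: dist_norm mult_left_le_one_le)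
      show "(f has_derivative D y) (at y within cball a (norm (x - a)))" for y
        using D(1) has_derivative_at_withinI by blast
      show "onorm (D y - D a) \<le> K * norm (x - a)" if "y \<in> cball a (norm (x - a))" for y
      proof -
        have n: "norm (y - a) \<le> norm (x - a)" using that by (simp add: dist_norm norm_minus_commute)
        then have "onorm (\<lambda>v. D y v - D a v) \<le> K * norm (y - a)"
          using x by (intro K) (auto simp: dist_norm norm_minus_commute)
        also have "\<dots> \<le> K * norm (x - a)"
          using n by (intro mult_left_mono) (auto simp: K_def sum_nonneg)
        finally show ?thesis by (simp add: fun_diff_def)
      qed
    qed simp
    then show "norm (f x - f a - f' (x - a)) \<le> K * (norm (x - a))\<^sup>2"
      by (simp add: Da power2_eq_square algebra_simps)
  qed (rule e(1))
qed

section \<open>The implicit function theorem\<close>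

text \<open>This makes the derivative of an inverse function continuous. The difference of the
  solutions \<open>h y\<close> and \<open>h y0\<close> solves
  \<open>T y0 (h y - h y0) = (T y0 - T y) (h y)\<close>, and \<open>T y0\<close> is bounded
  below.\<close>

lemma continuous_on_inv_blinfun:
  fixes T :: "'c::topological_space \<Rightarrow> 'a::euclidean_space \<Rightarrow>\<^sub>L 'b::euclidean_space"
  assumes T: "continuous_on S T" and bij: "\<And>y. y \<in> S \<Longrightarrow> bij (blinfun_apply (T y))"
  shows "continuous_on S (\<lambda>y. inv (blinfun_apply (T y)) u)"
  unfolding continuous_on_def
proof
  fix y0 assume y0: "y0 \<in> S"
  define h where "h y = inv (blinfun_apply (T y)) u" for y
  have Th: "blinfun_apply (T y) (h y) = u" if "y \<in> S" for y
    using bij[OF that] by (simp add: h_def bij_is_surj surj_f_inv_f)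
  obtain m where m: "m > 0" "\<And>w. m * norm w \<le> norm (T y0 w)"
    using linear_inj_bounded_below_pos[of "blinfun_apply (T y0)"] bij[OF y0]
    by (metis bounded_linear.linear[OF blinfun.bounded_linear_right] bij_is_inj)
  have lim: "((\<lambda>y. norm (T y0 - T y)) \<longlongrightarrow> 0) (at y0 within S)"
    using T y0 by (intro tendsto_norm_zero tendsto_eq_intros) (auto simp: continuous_on_def)
  \<comment> \<open>The factor 1/2 allows the term with \<open>norm (h y - h y0)\<close> on the
    right to be absorbed into the left side below.\<close>
  have "\<forall>\<^sub>F y in at y0 within S. norm (T y0 - T y) < m / 2"
    using order_tendstoD(2)[OF lim, of "m / 2"] m(1) by simp
  moreover have "\<forall>\<^sub>F y in at y0 within S. y \<in> S"
    by (simp add: eventually_at_filter)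
  ultimately have "\<forall>\<^sub>F y in at y0 within S.
      norm (h y - h y0) \<le> norm (T y0 - T y) * (2 / m * norm (h y0))"
  proof eventually_elim
    case (elim y)
    let ?e = "norm (T y0 - T y)"
    have "T y0 (h y - h y0) = (T y0 - T y) (h y)"
      using Th[OF y0] Th[OF elim(2)] by (simp add: blinfun.diff_right blinfun.diff_left)
    then have "m * norm (h y - h y0) \<le> ?e * norm (h y)"
      using m(2)[of "h y - h y0"] norm_blinfun[of "T y0 - T y" "h y"] by simp
    also have "\<dots> \<le> ?e * (norm (h y - h y0) + norm (h y0))"
      by (intro mult_left_mono order_trans[OF norm_triangle_sub[of _ "h y0"]]) auto
    also have "\<dots> \<le> m / 2 * norm (h y - h y0) + ?e * norm (h y0)"
      using mult_right_mono[OF less_imp_le[OF elim(1)], of "norm (h y - h y0)"]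
      by (simp add: algebra_simps)
    finally show ?case using m(1) by (simp add: field_simps)
  qed
  then have "((\<lambda>y. h y - h y0) \<longlongrightarrow> 0) (at y0 within S)"
    by (rule Lim_null_comparison[OF _ tendsto_mult_left_zero[OF lim]])
  then show "((\<lambda>y. inv (blinfun_apply (T y)) u) \<longlongrightarrow> inv (blinfun_apply (T y0)) u) (at y0 within S)"
    by (simp add: h_def[symmetric] LIM_zero_iff)
qed

text \<open>The inverse function theorem is applied to \<open>G (x, y) = (F (x, y), y)\<close>; the
  first component of its local inverse at \<open>(0, y)\<close> is the implicit function. Since
  \<open>F\<close> takes values in \<open>'a\<close>, injectivity of the partial derivative already
  means invertibility.\<close>

lemma implicit_function:
  fixes F :: "'a::euclidean_space \<times> 'b::euclidean_space \<Rightarrow> 'a"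
  assumes F': "\<And>z. (F has_derivative F' z) (at z)"
    and cont: "\<And>v. continuous_on UNIV (\<lambda>z. F' z v)"
    and zero: "F (a, b) = 0"
    and inj: "\<And>v. F' (a, b) (v, 0) = 0 \<Longrightarrow> v = 0"
  obtains U V \<phi> \<phi>' where "open U" "b \<in> U" "open V" "a \<in> V" "\<phi> b = a"
    "\<And>y. y \<in> U \<Longrightarrow> \<phi> y \<in> V" "\<And>y. y \<in> U \<Longrightarrow> F (\<phi> y, y) = 0"
    "\<And>x y. y \<in> U \<Longrightarrow> x \<in> V \<Longrightarrow> F (x, y) = 0 \<Longrightarrow> x = \<phi> y"
    "\<And>y. y \<in> U \<Longrightarrow> (\<phi> has_derivative \<phi>' y) (at y)"
    "\<And>v. continuous_on U (\<lambda>y. \<phi>' y v)"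
proof -
  define G where "G z = (F z, snd z)" for z
  define G' where "G' z = Blinfun (\<lambda>v. (F' z v, snd v))" for z
  have blF: "bounded_linear (F' z)" for z using F' by (rule has_derivative_bounded_linear)
  have G'_apply: "blinfun_apply (G' z) = (\<lambda>v. (F' z v, snd v))" for z
    unfolding G'_def
    by (intro bounded_linear_Blinfun_apply bounded_linear_Pair blF bounded_linear_snd)
  have derG: "(G has_derivative blinfun_apply (G' z)) (at z)" for z
    unfolding G'_apply G_def by (intro has_derivative_Pair F' has_derivative_snd has_derivative_ident)
  have contG: "continuous_on UNIV G'"
    by (intro continuous_on_blinfun_componentwise) (auto simp: G'_apply intro!: continuous_intros cont)
  \<comment> \<open>The second component of \<open>G'\<close> forces a kernel vector into the form
    \<open>(v, 0)\<close>, to which the hypothesis on \<open>F'\<close> applies.\<close>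
  have "inj (blinfun_apply (G' (a, b)))"
    unfolding linear_injective_0[OF bounded_linear.linear[OF blinfun.bounded_linear_right]]
    using inj by (auto simp: G'_apply zero_prod_def)
  then obtain L where L: "linear L" "L \<circ> blinfun_apply (G' (a, b)) = id"
    using linear_injective_left_inverse[OF bounded_linear.linear[OF blinfun.bounded_linear_right]] by blast
  have "Blinfun L o\<^sub>L G' (a, b) = id_blinfun"
    using L by (intro blinfun_eqI)
      (metis L(2) blinfun_apply_blinfun_compose blinfun_apply_id_blinfun bounded_linear_Blinfun_apply
        comp_apply id_apply linear_conv_bounded_linear)
  then obtain X W g g' where X: "open X" "(a, b) \<in> X" "open W" "G (a, b) \<in> W"
      and hom: "homeomorphism X W G g"
      and g': "\<And>y. y \<in> W \<Longrightarrow> (g has_derivative g' y) (at y)"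
        "\<And>y. y \<in> W \<Longrightarrow> g' y = inv (blinfun_apply (G' (g y)))"
        "\<And>y. y \<in> W \<Longrightarrow> bij (blinfun_apply (G' (g y)))"
    using inverse_function_theorem[OF open_UNIV derG contG UNIV_I] by metis
  have contg: "continuous_on W g" using hom by (simp add: homeomorphism_def)
  \<comment> \<open>A box inside \<open>X\<close>, so that one fixed \<open>V\<close> serves for the
    uniqueness of the root for every parameter.\<close>
  obtain V U0 where VU: "open V" "open U0" "a \<in> V" "b \<in> U0" "V \<times> U0 \<subseteq> X"
    using open_prod_elim[OF X(1,2)] by (metis mem_Sigma_iff)
  define \<phi> where "\<phi> y = fst (g (0, y))" for y
  define U1 where "U1 = U0 \<inter> (\<lambda>y. (0, y)) -` W"
  have "open U1"
    unfolding U1_def using VU X by (intro continuous_open_preimage continuous_intros)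
  have cpair: "continuous_on U1 (\<lambda>y. (0::'a, y))" "(\<lambda>y. (0, y)) ` U1 \<subseteq> W"
    by (auto intro!: continuous_intros simp: U1_def)
  \<comment> \<open>Shrinking the parameter set keeps the values of \<open>\<phi>\<close> inside
    \<open>V\<close>.\<close>
  define U where "U = U1 \<inter> \<phi> -` V"
  have "open U"
    unfolding U_def \<phi>_def using \<open>open U1\<close> \<open>open V\<close> cpair
    by (intro continuous_open_preimage continuous_on_fst continuous_on_compose2[OF contg]) auto
  have UW: "(0, y) \<in> W" if "y \<in> U" for y using that by (auto simp: U_def U1_def)
  have gU: "g (0, y) = (\<phi> y, y) \<and> F (\<phi> y, y) = 0" if "(0, y) \<in> W" for y
  proof -
    have "G (g (0, y)) = (0, y)" using hom that by (simp add: homeomorphism_def)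
    then show ?thesis by (simp add: G_def \<phi>_def) (metis prod.collapse)
  qed
  have uniq: "x = \<phi> y" if "y \<in> U0" "x \<in> V" "F (x, y) = 0" for x y
  proof -
    have "g (G (x, y)) = (x, y)" using VU that hom by (auto simp: homeomorphism_def)
    then show ?thesis using that by (simp add: G_def \<phi>_def)
  qed
  have "\<phi> b = a" using uniq[of b a] VU zero by simp
  then have "b \<in> U" using VU X zero by (simp add: U_def U1_def G_def)
  show thesis
  proof (rule that[where \<phi> = \<phi> and \<phi>' = "\<lambda>y v. fst (g' (0, y) (0, v))",
        OF \<open>open U\<close> \<open>b \<in> U\<close> VU(1,3) \<open>\<phi> b = a\<close>])
    fix y assume y: "y \<in> U"
    show "\<phi> y \<in> V" "F (\<phi> y, y) = 0" using y gU UW by (auto simp: U_def)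
    show "x = \<phi> y" if "x \<in> V" "F (x, y) = 0" for x
      using y that by (intro uniq) (auto simp: U_def U1_def)
    show "(\<phi> has_derivative (\<lambda>v. fst (g' (0, y) (0, v)))) (at y)"
      unfolding \<phi>_def
      by (intro has_derivative_fst has_derivative_compose[where f = "\<lambda>y. (0, y)", OF _ g'(1)[OF UW[OF y]]])
        (auto intro!: derivative_eq_intros)
  next
    have "continuous_on W (\<lambda>w. G' (g w))"
      by (rule continuous_on_compose2[OF contG contg]) simp
    then have "continuous_on W (\<lambda>w. g' w u)" for u
      using continuous_on_inv_blinfun[of W "\<lambda>w. G' (g w)" u] g'(2,3)
      by (simp cong: continuous_on_cong)
    then show "continuous_on U (\<lambda>y. fst (g' (0, y) (0, v)))" for v
      by (intro continuous_on_fst continuous_on_compose2[of W "\<lambda>w. g' w (0, v)" U "\<lambda>y. (0, y)"])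
        (auto intro!: continuous_intros simp: UW)
  qed
qed

section \<open>The concatenated KKT map\<close>

lemma inner_grad:
  assumes "F differentiable (at x)"
  shows "grad F x \<bullet> s = frechet_derivative F (at x) s"
  by (simp add: frechet_derivative_partial[OF assms] grad_def inner_vec_def mult.commute)

lemma has_derivative_inner_grad:
  assumes "F differentiable (at x)"
  shows "(F has_derivative (\<lambda>s. grad F x \<bullet> s)) (at x)"
  using assms by (simp add: inner_grad frechet_derivative_works[symmetric])

lemma has_derivative_partial_hess:
  assumes "\<And>l. partial l F differentiable (at x)"
  shows "(partial k F has_derivative (\<lambda>s. (hess F x *v s) $ k)) (at x)"
proof -
  have "(grad F has_derivative (\<lambda>v. \<chi> l. frechet_derivative (partial l F) (at x) v)) (at x)"
    unfolding grad_def using assms frechet_derivative_works by (intro has_derivative_vec) blast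
  then have "(grad F has_derivative (*v) (hess F x)) (at x)"
    unfolding hess_def by (metis differentiableI jacobian_works)
  from bounded_linear.has_derivative[OF bounded_linear_vec_nth this, of k] show ?thesis by (simp add: grad_def)
qed

lemma has_derivative_partial:
  assumes "(F has_derivative F') (at x)"
  shows "partial k F x = F' (axis k 1)"
  using frechet_derivative_at[OF assms] by (simp add: partial_def)

text \<open>The function is constant along the line through \<open>x\<close> in direction
  \<open>axis k 1\<close>, and the chain rule identifies its derivative there with the partial
  derivative.\<close>

lemma partial_eq_0_if_independent:
  assumes F: "F differentiable (at x)" and "depends_only_on S F" "k \<notin> S"
  shows "partial k F x = 0"
proof -
  have "F (x + t *\<^sub>R axis k 1) = F x" for t
    using assms(3) by (intro assms(2)[unfolded depends_only_on_def, rule_format]) (auto simp: axis_def)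
  moreover have "((\<lambda>t. F (x + t *\<^sub>R axis k 1)) has_derivative
      (\<lambda>t. frechet_derivative F (at x) (t *\<^sub>R axis k 1))) (at 0)"
    using F[unfolded frechet_derivative_works]
    by (intro has_derivative_compose[where f = "\<lambda>t. x + t *\<^sub>R axis k 1" and g = F])
      (auto intro!: derivative_eq_intros)
  ultimately have "((\<lambda>t::real. F x) has_derivative
      (\<lambda>t. frechet_derivative F (at x) (t *\<^sub>R axis k 1))) (at 0)" by simp
  from has_derivative_unique[OF this has_derivative_const]
  show ?thesis unfolding partial_def by (metis scaleR_one)
qed

lemma times_cont_diff_partial: "times_cont_diff 3 F \<Longrightarrow> times_cont_diff 2 (partial k F)"
  and times_cont_diff_differentiable: "times_cont_diff 3 F \<Longrightarrow> F differentiable (at x)"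
  and times_cont_diff_partial_differentiable:
    "times_cont_diff 3 F \<Longrightarrow> partial k F differentiable (at x)"
  by (simp_all add: numeral_3_eq_3 numeral_2_eq_2)

lemma bounded_linear_mix:
  "bounded_linear (\<lambda>z. mix P i (xpart P (fst z)) (xpart P (snd z)))"
  unfolding linear_conv_bounded_linear[symmetric]
  by (intro linearI) (auto simp: mix_def xpart_def vec_eq_iff)

lemma bounded_linear_xpart: "bounded_linear (xpart P)"
  unfolding linear_conv_bounded_linear[symmetric]
  by (intro linearI) (auto simp: xpart_def vec_eq_iff)

lemma mix_same [simp]: "mix P i x x = x"
  by (simp add: mix_def vec_eq_iff)

lemma has_derivative_mix:
  "((\<lambda>p. mix P i (xpart P p) y) has_derivative (\<lambda>v. block P i (xpart P v))) (at p)"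
proof -
  have "mix P i (xpart P p) y = block P i (xpart P p) + mix P i 0 y" for p
    by (simp add: mix_def block_def vec_eq_iff)
  moreover have "bounded_linear (\<lambda>v. block P i (xpart P v))"
    unfolding linear_conv_bounded_linear[symmetric]
    by (intro linearI) (auto simp: block_def xpart_def vec_eq_iff)
  ultimately show ?thesis
    by (auto intro!: derivative_eq_intros bounded_linear_imp_has_derivative)
qed

context
  fixes P :: "('v::finite, 'n::finite, 'p::finite) nlp"
  assumes P: "central_nlp P"
begin

lemma smooth:
  "times_cont_diff 3 (fobj P i)"
  "c \<in> eqs_of P i \<Longrightarrow> times_cont_diff 3 (gcon P c)"
  "c \<in> ineqs_of P i \<Longrightarrow> times_cont_diff 3 (hcon P c)"
  using P by (auto simp: central_nlp_def eqs_of_def ineqs_of_def)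

lemma has_derivative_agent_lagrangian:
  "(agent_lagrangian P i p has_derivative
     (\<lambda>v. frechet_derivative (fobj P i) (at x) v +
        (\<Sum>c\<in>eqs_of P i. p $ c * frechet_derivative (gcon P c) (at x) v) +
        (\<Sum>c\<in>ineqs_of P i. p $ c * frechet_derivative (hcon P c) (at x) v))) (at x)"
  unfolding agent_lagrangian_def[abs_def]
  by (intro has_derivative_add has_derivative_sum has_derivative_mult_right)
    (use smooth[THEN times_cont_diff_differentiable] frechet_derivative_works in blast)+

lemma partial_agent_lagrangian:
  "partial k (agent_lagrangian P i p) x = partial k (fobj P i) x +
     (\<Sum>c\<in>eqs_of P i. p $ c * partial k (gcon P c) x) +
     (\<Sum>c\<in>ineqs_of P i. p $ c * partial k (hcon P c) x)"
  unfolding has_derivative_partial[OF has_derivative_agent_lagrangian] by (simp add: partial_def)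

lemma partial_lagrangian:
  "partial k (lagrangian P p) x = (\<Sum>i\<in>UNIV. partial k (agent_lagrangian P i p) x)"
proof -
  have "agent_lagrangian P i p differentiable (at x)" for i
    using has_derivative_agent_lagrangian differentiableI by blast
  then have "(lagrangian P p has_derivative
      (\<lambda>v. \<Sum>i\<in>UNIV. frechet_derivative (agent_lagrangian P i p) (at x) v)) (at x)"
    unfolding lagrangian_def[abs_def] using frechet_derivative_works
    by (intro has_derivative_sum) blast
  from has_derivative_partial[OF this] show ?thesis by (simp add: partial_def)
qed

lemma agent_lagrangian_depends_only_on:
  "depends_only_on (xcoords P (insert i (nbrs P i))) (agent_lagrangian P i p)"
proof -
  have "depends_only_on (xcoords P (insert i (nbrs P i))) (fobj P i)"
    "\<And>c. c \<in> eqs_of P i \<Longrightarrow> depends_only_on (xcoords P (insert i (nbrs P i))) (gcon P c)"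
    "\<And>c. c \<in> ineqs_of P i \<Longrightarrow> depends_only_on (xcoords P (insert i (nbrs P i))) (hcon P c)"
    using P by (auto simp: central_nlp_def eqs_of_def ineqs_of_def)
  then show ?thesis
    unfolding depends_only_on_def agent_lagrangian_def
    by (intro allI impI arg_cong2[of _ _ _ _ "(+)"] sum.cong arg_cong2[of _ _ _ _ "(*)"] refl)
      blast+
qed

lemma xpos_coordinate: "xpos P k \<notin> eqs P" "xpos P k \<notin> ineqs P" "inv (xpos P) (xpos P k) = k"
proof -
  have "inj (xpos P)" "range (xpos P) \<inter> eqs P = {}" "range (xpos P) \<inter> ineqs P = {}"
    using P by (simp_all add: central_nlp_def)
  then show "xpos P k \<notin> eqs P" "xpos P k \<notin> ineqs P" "inv (xpos P) (xpos P k) = k"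
    by auto
qed

lemma coordinate_cases:
  obtains (eq) "c \<in> eqs P" | (ineq) "c \<in> ineqs P" "c \<notin> eqs P"
  | (x) k where "c = xpos P k" "xpos P k \<notin> eqs P" "xpos P k \<notin> ineqs P" "inv (xpos P) c = k"
proof (cases "c \<in> range (xpos P)")
  case True
  then obtain k where k: "c = xpos P k" by auto
  with xpos_coordinate show thesis by (intro x) auto
next
  case False
  have "range (xpos P) \<union> eqs P \<union> ineqs P = UNIV" using P by (simp add: central_nlp_def)
  then show thesis using False eq ineq by blast
qed

text \<open>The order 2 comes from the stationarity rows, which contain first partial derivatives of
  functions of class C^3. All rows are sums of products of multipliers with functions of class C^2
  after linear maps.\<close>

lemma ck_Fhat: "ck 2 (\<lambda>z. Fhat P (fst z) (snd z))"
proof (rule ck_vec)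
  fix c
  have coord: "ck 2 (\<lambda>z :: (real^'p) \<times> (real^'p). fst z $ d)"
    "ck 2 (\<lambda>z :: (real^'p) \<times> (real^'p). snd z $ d)" for d
    by (intro ck_bounded_linear bounded_linear_compose[OF bounded_linear_vec_nth]
        bounded_linear_fst bounded_linear_snd)+
  have mix: "ck 2 (\<lambda>z. F (mix P i (xpart P (fst z)) (xpart P (snd z))))" if "ck 2 F" for F :: "_ \<Rightarrow> real" and i
    using ck_compose_linear[OF bounded_linear_mix that] .
  have snd: "ck 2 (\<lambda>z. F (xpart P (snd (z :: (real^'p) \<times> (real^'p)))))" if "ck 2 F" for F :: "_ \<Rightarrow> real"
    by (intro ck_compose_linear[OF _ that] bounded_linear_compose[OF bounded_linear_xpart]
        bounded_linear_snd)
  have ck2: "ck 2 F" if "times_cont_diff 3 F" for F :: "real^'n \<Rightarrow> real"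
    using ck_if_times_cont_diff[OF that] ck_Suc_imp[of 2 F] by (simp add: numeral_3_eq_3 numeral_2_eq_2)
  have ckp: "ck 2 (partial k F)" if "times_cont_diff 3 F" for F :: "real^'n \<Rightarrow> real" and k
    using ck_if_times_cont_diff[OF times_cont_diff_partial[OF that]] .
  show "ck 2 (\<lambda>z. Fhat P (fst z) (snd z) $ c)"
  proof (cases c rule: coordinate_cases)
    case eq
    then show ?thesis using P by (auto simp: Fhat_def Let_def central_nlp_def intro!: mix ck2)
  next
    case ineq
    then show ?thesis
      using P by (auto simp: Fhat_def Let_def central_nlp_def intro!: ck_mult coord mix ck2)
  next
    case (x k)
    then show ?thesis
      by (auto simp: Fhat_def Let_def partial_agent_lagrangian
          intro!: ck_add ck_sum ck_mult coord mix snd ckp smooth)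
  qed
qed

text \<open>At equal arguments the stationarity rows are those of the central problem: only the
  owner of a coordinate and its neighbors have Lagrangians depending on it, by symmetry of the
  graph. The linear terms in the local objectives supply the neighbors' share.\<close>

lemma Fhat_central_kkt_point:
  assumes "central_kkt_point P ps"
  shows "Fhat P ps ps = 0"
proof -
  have "Fhat P ps ps $ c = 0" for c
  proof (cases c rule: coordinate_cases)
    case (x k)
    let ?i = "owner P (xpos P k)" and ?D = "\<lambda>j. partial k (agent_lagrangian P j ps) (xpart P ps)"
    have "?D j = 0" if "j \<notin> insert ?i (nbrs P ?i)" for j
    proof (rule partial_eq_0_if_independent[OF _ agent_lagrangian_depends_only_on])
      show "agent_lagrangian P j ps differentiable (at (xpart P ps))"
        using has_derivative_agent_lagrangian differentiableI by blast
      show "k \<notin> xcoords P (insert j (nbrs P j))"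
        using that P by (auto simp: xcoords_def nbrs_def central_nlp_def dest: symD)
    qed
    then have "(\<Sum>j\<in>UNIV. ?D j) = (\<Sum>j\<in>insert ?i (nbrs P ?i). ?D j)"
      by (intro sum.mono_neutral_right) auto
    also have "\<dots> = ?D ?i + (\<Sum>j\<in>nbrs P ?i. ?D j)"
      by (intro sum.insert) (auto simp: nbrs_def)
    finally have "Fhat P ps ps $ c = grad (lagrangian P ps) (xpart P ps) $ k"
      using x by (simp add: Fhat_def Let_def grad_def partial_lagrangian)
    then show ?thesis using assms by (simp add: central_kkt_point_def)
  qed (use assms in \<open>auto simp: Fhat_def Let_def central_kkt_point_def\<close>)
  then show ?thesis by (simp add: vec_eq_iff)
qed

text \<open>
  Near \<open>ps\<close> the multipliers of the active constraints stay positive and the inactive constraints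
  stay negative, so the complementarity equations alone force the signs.
\<close>

lemma local_kkt_if_Fhat_eq_0_near:
  assumes "central_kkt_point P ps" "strict_complementarity P ps"
  shows "\<forall>\<^sub>F z in nhds (ps, ps). Fhat P (fst z) (snd z) = 0 \<longrightarrow> local_kkt P (fst z) (snd z)"
proof -
  define h where "h c z = hcon P c (mix P (owner P c) (xpart P (fst z)) (xpart P (snd z)))" for c z
  have sign: "\<forall>\<^sub>F z in nhds (ps, ps). h c z < 0 \<or> fst z $ c > 0" if c: "c \<in> ineqs P" for c
  proof (cases "hcon P c (xpart P ps) = 0")
    case True
    then have "ps $ c > 0"
      using assms(2) c by (simp add: strict_complementarity_def active_def)
    moreover have "((\<lambda>z::(real^'p) \<times> (real^'p). fst z $ c) \<longlongrightarrow> fst (ps, ps) $ c) (nhds (ps, ps))"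
      by (intro tendsto_vec_nth tendsto_fst) (simp add: filterlim_ident)
    ultimately have "\<forall>\<^sub>F z in nhds (ps, ps). fst z $ c > 0"
      using order_tendstoD(1)[of _ "ps $ c"] by simp
    then show ?thesis by eventually_elim simp
  next
    case False
    have "times_cont_diff 3 (hcon P c)" using P c by (simp add: central_nlp_def)
    then have "continuous_on UNIV (hcon P c)"
      by (intro continuous_at_imp_continuous_on ballI differentiable_imp_continuous_within
          times_cont_diff_differentiable)
    then have "continuous_on UNIV (h c)" unfolding h_def
      by (rule continuous_on_compose2[OF _ linear_continuous_on[OF bounded_linear_mix]]) simp
    then have "isCont (h c) (ps, ps)" by (simp add: continuous_on_eq_continuous_at)
    moreover have "h c (ps, ps) < 0"
      using False assms(1) c by (simp add: h_def central_kkt_point_def order_less_le)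
    ultimately have "\<forall>\<^sub>F z in nhds (ps, ps). h c z < 0"
      using order_tendstoD(2)[of "h c"] by (simp add: isCont_def tendsto_at_iff_tendsto_nhds)
    then show ?thesis by eventually_elim simp
  qed
  have "\<forall>\<^sub>F z in nhds (ps, ps). \<forall>c\<in>ineqs P. h c z < 0 \<or> fst z $ c > 0"
    using sign by (intro eventually_ball_finite) auto
  then show ?thesis
  proof eventually_elim
    case (elim z)
    show ?case
    proof
      assume F: "Fhat P (fst z) (snd z) = 0"
      have "fst z $ c * h c z = 0" if "c \<in> ineqs P" for c
      proof -
        have "Fhat P (fst z) (snd z) $ c = fst z $ c * h c z"
          using that P by (auto simp: Fhat_def Let_def h_def central_nlp_def)
        then show ?thesis using F by simp
      qed
      then show "local_kkt P (fst z) (snd z)"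
        using elim F unfolding local_kkt_def h_def by (metis less_eq_real_def mult_eq_0_iff less_irrefl)
    qed
  qed
qed

lemma has_derivative_Fhat:
  fixes ps :: "real^'p"
  defines "x \<equiv> xpart P ps"
  defines "s \<equiv> \<lambda>c v. block P (owner P c) (xpart P v)"
  shows "c \<in> eqs P \<Longrightarrow>
      ((\<lambda>p. Fhat P p ps $ c) has_derivative (\<lambda>v. grad (gcon P c) x \<bullet> s c v)) (at ps)"
    and "c \<in> ineqs P \<Longrightarrow> ((\<lambda>p. Fhat P p ps $ c) has_derivative
        (\<lambda>v. v $ c * hcon P c x + ps $ c * (grad (hcon P c) x \<bullet> s c v))) (at ps)"
    and "((\<lambda>p. Fhat P p ps $ xpos P k) has_derivative
        (\<lambda>v. (hess (agent_lagrangian P (owner P (xpos P k)) ps) x *v s (xpos P k) v) $ k +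
          (\<Sum>c\<in>eqs_of P (owner P (xpos P k)). v $ c * partial k (gcon P c) x) +
          (\<Sum>c\<in>ineqs_of P (owner P (xpos P k)). v $ c * partial k (hcon P c) x))) (at ps)"
proof -
  have mix: "((\<lambda>p. F (mix P i (xpart P p) x)) has_derivative (\<lambda>v. F' (block P i (xpart P v)))) (at ps)"
    if "(F has_derivative F') (at x)" for F :: "_ \<Rightarrow> real" and F' i
    by (rule has_derivative_compose[OF has_derivative_mix]) (use that in \<open>simp add: x_def\<close>)
  { assume c: "c \<in> eqs P"
    then have "times_cont_diff 3 (gcon P c)" using P by (simp add: central_nlp_def)
    from mix[OF has_derivative_inner_grad[OF times_cont_diff_differentiable[OF this]]]
    show "((\<lambda>p. Fhat P p ps $ c) has_derivative (\<lambda>v. grad (gcon P c) x \<bullet> s c v)) (at ps)"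
      using c by (simp add: Fhat_def Let_def s_def x_def)
  }
  { assume c: "c \<in> ineqs P"
    then have "times_cont_diff 3 (hcon P c)" using P by (simp add: central_nlp_def)
    note h = mix[OF has_derivative_inner_grad[OF times_cont_diff_differentiable[OF this]]]
    have "c \<notin> eqs P" using c P by (auto simp: central_nlp_def)
    then show "((\<lambda>p. Fhat P p ps $ c) has_derivative
        (\<lambda>v. v $ c * hcon P c x + ps $ c * (grad (hcon P c) x \<bullet> s c v))) (at ps)"
      using c has_derivative_mult[OF bounded_linear_imp_has_derivative[OF bounded_linear_vec_nth, of c] h[of "owner P c"]]
      by (simp add: Fhat_def Let_def s_def x_def add.commute)
  }
  define i where "i = owner P (xpos P k)"
  let ?L = "agent_lagrangian P i ps"
  let ?m = "\<lambda>p. mix P i (xpart P p) x"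
  let ?N = "\<Sum>j\<in>nbrs P i. partial k (agent_lagrangian P j ps) x"
  have "partial l ?L differentiable (at x)" for l
    unfolding partial_agent_lagrangian[abs_def]
    by (intro differentiable_add differentiable_sum differentiable_mult differentiable_const
        ballI finite times_cont_diff_partial_differentiable smooth)
  note hess = mix[OF has_derivative_partial_hess[OF this]]
  \<comment> \<open>The Lagrangian is affine in the multipliers; expanding at \<open>ps\<close> isolates the Hessian term.\<close>
  have F: "Fhat P p ps $ xpos P k = partial k ?L (?m p) +
      (\<Sum>c\<in>eqs_of P i. (p $ c - ps $ c) * partial k (gcon P c) (?m p)) +
      (\<Sum>c\<in>ineqs_of P i. (p $ c - ps $ c) * partial k (hcon P c) (?m p)) + ?N" for p
    using xpos_coordinate by (simp add: Fhat_def Let_def partial_agent_lagrangian i_def[symmetric] x_def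
        left_diff_distrib sum_subtractf)
  \<comment> \<open>The first factor vanishes at \<open>ps\<close>, so the product rule leaves a
    single term.\<close>
  have summand: "((\<lambda>p. (p $ c - ps $ c) * partial k G (?m p)) has_derivative
      (\<lambda>v. v $ c * partial k G x)) (at ps)" if "times_cont_diff 3 G" for G c
  proof -
    have G: "(partial k G has_derivative frechet_derivative (partial k G) (at x)) (at x)"
      using times_cont_diff_partial_differentiable[OF that] frechet_derivative_works by blast
    have "((\<lambda>p. p $ c - ps $ c) has_derivative (\<lambda>v. v $ c)) (at ps)"
      by (auto intro!: derivative_eq_intros bounded_linear_imp_has_derivative bounded_linear_vec_nth)
    from has_derivative_mult[OF this mix[OF G]] show ?thesis by (simp add: x_def)
  qed
  have "((\<lambda>p. Fhat P p ps $ xpos P k) has_derivative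
      (\<lambda>v. (hess ?L x *v block P i (xpart P v)) $ k +
        (\<Sum>c\<in>eqs_of P i. v $ c * partial k (gcon P c) x) +
        (\<Sum>c\<in>ineqs_of P i. v $ c * partial k (hcon P c) x) + 0)) (at ps)"
    unfolding F
    by (intro has_derivative_add has_derivative_sum summand hess has_derivative_const smooth)
  then show "((\<lambda>p. Fhat P p ps $ xpos P k) has_derivative
        (\<lambda>v. (hess (agent_lagrangian P (owner P (xpos P k)) ps) x *v s (xpos P k) v) $ k +
          (\<Sum>c\<in>eqs_of P (owner P (xpos P k)). v $ c * partial k (gcon P c) x) +
          (\<Sum>c\<in>ineqs_of P (owner P (xpos P k)). v $ c * partial k (hcon P c) x))) (at ps)"
    by (simp add: i_def s_def)
qed

section \<open>Regularity of the local KKT systems\<close>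

text \<open>For each agent, the stationarity row tested with the primal block \<open>s i\<close>
  loses its constraint terms, since \<open>s i\<close> is orthogonal to the gradients. The local
  second-order condition then gives \<open>s i = 0\<close>. What remains of stationarity is a linear
  relation between constraint gradients, excluded by the local LICQ.\<close>

lemma Fhat_derivative_eq_0_imp_eq_0:
  assumes kkt: "central_kkt_point P ps" and sc: "strict_complementarity P ps"
    and A2: "assumption2 P ps"
    and D: "((\<lambda>p. Fhat P p ps) has_derivative D) (at ps)" and Dv: "D v = 0"
  shows "v = 0"
proof -
  define x where "x = xpart P ps"
  define s where "s i = block P i (xpart P v)" for i
  define A where "A i = agent_active P i x" for i
  have Dc: "D' v = 0" if "((\<lambda>p. Fhat P p ps $ c) has_derivative D') (at ps)" for c D'
    using has_derivative_unique[OF that bounded_linear.has_derivative[OF bounded_linear_vec_nth D]] Dv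
    by simp
  have eq: "grad (gcon P c) x \<bullet> s (owner P c) = 0" if "c \<in> eqs P" for c
    using Dc[OF has_derivative_Fhat(1)[OF that]] by (simp add: x_def s_def)
  have ineq: "v $ c * hcon P c x + ps $ c * (grad (hcon P c) x \<bullet> s (owner P c)) = 0"
    if "c \<in> ineqs P" for c
    using Dc[OF has_derivative_Fhat(2)[OF that]] by (simp add: x_def s_def)
  \<comment> \<open>Complementarity gives \<open>ps $ c = 0\<close> here, so the row reduces to
    \<open>v $ c * hcon P c x = 0\<close>.\<close>
  have inactive: "v $ c = 0" if "c \<in> ineqs P" "hcon P c x \<noteq> 0" for c
    using ineq[OF that(1)] that kkt by (auto simp: central_kkt_point_def x_def)
  \<comment> \<open>The row reduces to \<open>ps $ c\<close> times the inner product, and strict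
    complementarity makes \<open>ps $ c\<close> positive.\<close>
  have active: "grad (hcon P c) x \<bullet> s (owner P c) = 0" if "c \<in> ineqs P" "hcon P c x = 0" for c
    using ineq[OF that(1)] that sc by (force simp: strict_complementarity_def active_def x_def)
  have disj: "c \<notin> eqs P" if "c \<in> ineqs P" for c using that P by (auto simp: central_nlp_def)
  have con: "con_grad P x c \<bullet> s i = 0" if "c \<in> eqs_of P i \<union> A i" for c i
    using that eq active disj
    by (auto simp: con_grad_def eqs_of_def A_def agent_active_def ineqs_of_def)
  \<comment> \<open>With the inactive multipliers gone, the sum runs over exactly the family whose
    independence LICQ asserts.\<close>
  have stat: "block P i (hess (agent_lagrangian P i ps) x *v s i) +
      (\<Sum>c\<in>eqs_of P i \<union> A i. v $ c *\<^sub>R block P i (con_grad P x c)) = 0" for i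
  proof -
    have "(hess (agent_lagrangian P i ps) x *v s i) $ k +
        (\<Sum>c\<in>eqs_of P i \<union> A i. v $ c * con_grad P x c $ k) = 0" if "k \<in> xcoords P {i}" for k
    proof -
      have i: "owner P (xpos P k) = i" using that by (simp add: xcoords_def)
      have "(\<Sum>c\<in>eqs_of P i \<union> A i. v $ c * con_grad P x c $ k) =
          (\<Sum>c\<in>eqs_of P i. v $ c * con_grad P x c $ k) + (\<Sum>c\<in>A i. v $ c * con_grad P x c $ k)"
        using disj by (intro sum.union_disjoint) (auto simp: eqs_of_def A_def agent_active_def ineqs_of_def)
      also have "(\<Sum>c\<in>A i. v $ c * con_grad P x c $ k) =
          (\<Sum>c\<in>ineqs_of P i. v $ c * con_grad P x c $ k)"
        by (rule sum.mono_neutral_left) (auto simp: A_def agent_active_def ineqs_of_def inactive)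
      also have "\<dots> = (\<Sum>c\<in>ineqs_of P i. v $ c * partial k (hcon P c) x)"
        using disj by (intro sum.cong) (auto simp: con_grad_def grad_def ineqs_of_def)
      also have "(\<Sum>c\<in>eqs_of P i. v $ c * con_grad P x c $ k) =
          (\<Sum>c\<in>eqs_of P i. v $ c * partial k (gcon P c) x)"
        by (intro sum.cong) (auto simp: con_grad_def grad_def eqs_of_def)
      finally show ?thesis
        using Dc[OF has_derivative_Fhat(3)[where k = k]] by (simp add: i x_def s_def)
    qed
    then show ?thesis by (simp add: vec_eq_iff block_def)
  qed
  have block_inner: "block P i w \<bullet> s i = w \<bullet> s i" for w i
    by (auto simp: block_def s_def inner_vec_def intro!: sum.cong)
  have block_s: "block P i (s i) = s i" for i by (simp add: block_def s_def vec_eq_iff)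
  have s0: "s i = 0" for i
  proof (rule ccontr)
    assume "s i \<noteq> 0"
    have "s i \<bullet> (hess (agent_lagrangian P i ps) x *v s i) > 0"
      using A2 \<open>s i \<noteq> 0\<close> block_s con unfolding assumption2_def local_sosc_def x_def A_def by blast
    moreover have "(block P i (hess (agent_lagrangian P i ps) x *v s i) +
        (\<Sum>c\<in>eqs_of P i \<union> A i. v $ c *\<^sub>R block P i (con_grad P x c))) \<bullet> s i = 0"
      by (simp only: stat inner_zero_left)
    then have "(hess (agent_lagrangian P i ps) x *v s i) \<bullet> s i = 0"
      by (simp add: inner_add_left inner_sum_left block_inner con)
    ultimately show False by (simp add: inner_commute)
  qed
  have v_con: "v $ c = 0" if "c \<in> eqs_of P i \<union> A i" for c i
  proof -
    let ?b = "\<lambda>c. block P i (con_grad P x c)" and ?S = "eqs_of P i \<union> A i"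
    have li: "inj_on ?b ?S" "independent (?b ` ?S)"
      using A2 by (simp_all add: assumption2_def local_licq_def lin_indep_family_def x_def A_def)
    have "block P i 0 = 0" by (simp add: block_def vec_eq_iff)
    then have 0: "(\<Sum>c\<in>?S. v $ c *\<^sub>R ?b c) = 0" using stat[of i] by (simp add: s0)
    \<comment> \<open>Independence concerns the set of gradients, not the family; injectivity of
      \<open>?b\<close> lets the coefficients be reindexed by the vectors themselves.\<close>
    have "(\<Sum>w\<in>?b ` ?S. v $ the_inv_into ?S ?b w *\<^sub>R w) =
        (\<Sum>c\<in>?S. v $ the_inv_into ?S ?b (?b c) *\<^sub>R ?b c)"
      by (simp add: sum.reindex[OF li(1)])
    also have "\<dots> = (\<Sum>c\<in>?S. v $ c *\<^sub>R ?b c)"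
      by (intro sum.cong refl) (simp only: the_inv_into_f_f[OF li(1)])
    also note 0
    finally have "v $ the_inv_into ?S ?b (?b c) = 0"
      using that by (intro independentD[OF li(2) _ subset_refl,
          where u = "\<lambda>w. v $ the_inv_into ?S ?b w"]) auto
    then show ?thesis by (simp add: the_inv_into_f_f[OF li(1) that])
  qed
  have "v $ c = 0" for c
  proof (cases c rule: coordinate_cases)
    case eq
    then show ?thesis using v_con[of c "owner P c"] by (simp add: eqs_of_def)
  next
    case ineq
    then show ?thesis using v_con[of c "owner P c"] inactive[of c]
      by (auto simp: A_def agent_active_def ineqs_of_def)
  next
    case (x k)
    have "s (owner P c) $ k = 0" by (simp add: s0)
    then show ?thesis using x by (simp add: s_def block_def xcoords_def xpart_def)
  qed
  then show ?thesis by (simp add: vec_eq_iff)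
qed

lemma Fhat_joint_derivative:
  obtains F' where
    "\<And>z. ((\<lambda>z. Fhat P (fst z) (snd z)) has_derivative F' z) (at z)"
    "\<And>v. continuous_on UNIV (\<lambda>z. F' z v)"
proof -
  obtain F' where F': "\<And>z. ((\<lambda>z. Fhat P (fst z) (snd z)) has_derivative F' z) (at z)"
    "\<And>v. ck 1 (\<lambda>z. F' z v)"
    using ck_Fhat by (auto simp: numeral_2_eq_2)
  have "ck 0 (\<lambda>z. F' z v)" for v by (rule ck_Suc_imp) (use F'(2) in simp)
  then show thesis using F'(1) by (intro that[of F']) simp_all
qed

section \<open>Existence of the solution mapping and its quadratic estimate\<close>

context
  fixes ps :: "real^'p"
  assumes kkt: "central_kkt_point P ps" and sc: "strict_complementarity P ps"
    and A2: "assumption2 P ps"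
begin

lemma joint_derivative_inj:
  assumes "((\<lambda>z. Fhat P (fst z) (snd z)) has_derivative F') (at (ps, ps))" "F' (v, 0) = 0"
  shows "v = 0"
proof (rule Fhat_derivative_eq_0_imp_eq_0[OF kkt sc A2])
  show "((\<lambda>p. Fhat P p ps) has_derivative (\<lambda>v. F' (v, 0))) (at ps)"
    using has_derivative_compose[of "\<lambda>p. (p, ps)" "\<lambda>v. (v, 0)" ps UNIV,
        OF has_derivative_Pair[OF has_derivative_ident has_derivative_const] assms(1)]
    by simp
qed (rule assms(2))

lemma solution_mapping_exists: "\<exists>\<Phi>. solution_mapping P ps \<Phi>"
proof -
  obtain F' where F':
    "\<And>z. ((\<lambda>z. Fhat P (fst z) (snd z)) has_derivative F' z) (at z)"
    "\<And>v. continuous_on UNIV (\<lambda>z. F' z v)"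
    using Fhat_joint_derivative by blast
  have 0: "Fhat P (fst (ps, ps)) (snd (ps, ps)) = 0"
    using Fhat_central_kkt_point[OF kkt] by simp
  obtain U V \<phi> \<phi>' where U: "open U" "ps \<in> U" and V: "open V" "ps \<in> V" and "\<phi> ps = ps"
    and \<phi>: "\<And>y. y \<in> U \<Longrightarrow> \<phi> y \<in> V" "\<And>y. y \<in> U \<Longrightarrow> Fhat P (\<phi> y) y = 0"
      "\<And>x y. y \<in> U \<Longrightarrow> x \<in> V \<Longrightarrow> Fhat P x y = 0 \<Longrightarrow> x = \<phi> y"
    and \<phi>': "\<And>y. y \<in> U \<Longrightarrow> (\<phi> has_derivative \<phi>' y) (at y)" "\<And>v. continuous_on U (\<lambda>y. \<phi>' y v)"
  proof (rule implicit_function[OF F' 0 joint_derivative_inj[OF F'(1)], unfolded fst_conv snd_conv],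
      goal_cases)
    case (2 U V \<phi> \<phi>')
    from 2(2-) show thesis by (rule 2(1))
  qed
  obtain W where W: "open W" "(ps, ps) \<in> W"
    "\<And>p pb. (p, pb) \<in> W \<Longrightarrow> Fhat P p pb = 0 \<Longrightarrow> local_kkt P p pb"
    using local_kkt_if_Fhat_eq_0_near[OF kkt sc] unfolding eventually_nhds
    by (metis fst_conv snd_conv)
  \<comment> \<open>On \<open>U'\<close> the pair \<open>(\<phi> y, y)\<close> stays in
    \<open>W\<close>, where a zero of \<open>Fhat P\<close> also satisfies the inequalities.\<close>
  define U' where "U' = U \<inter> (\<lambda>y. (\<phi> y, y)) -` W"
  have "continuous_on U \<phi>"
    using \<phi>'(1) by (intro continuous_at_imp_continuous_on ballI has_derivative_continuous)
  then have "open U'"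
    unfolding U'_def using U(1) W(1)
    by (intro continuous_open_preimage continuous_on_Pair continuous_on_id)
  have "jacobian \<phi> (at y) = (\<chi> i j. \<phi>' y (axis j 1) $ i)" if "y \<in> U" for y
    using frechet_derivative_at[OF \<phi>'(1)[OF that]] by (simp add: jacobian_def matrix_def)
  then have "continuous_on U (\<lambda>y. jacobian \<phi> (at y))"
    using \<phi>'(2) by (auto intro!: continuous_intros cong: continuous_on_cong)
  then have "continuous_on U' (\<lambda>y. jacobian \<phi> (at y))"
    by (rule continuous_on_subset) (simp add: U'_def)
  moreover have "\<forall>p\<in>V. local_kkt P p y \<longrightarrow> p = \<phi> y" if "y \<in> U" for y
    using \<phi>(3)[OF that] by (auto simp: local_kkt_def)
  moreover have "\<phi> y \<in> V \<and> local_kkt P (\<phi> y) y \<and> \<phi> differentiable (at y)" if "y \<in> U'" for y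
    using that \<phi>(1,2) differentiableI[OF \<phi>'(1)] W(3) by (auto simp: U'_def)
  moreover have "ps \<in> U'" using U W \<open>\<phi> ps = ps\<close> by (simp add: U'_def)
  ultimately have "solution_mapping P ps \<phi>"
    unfolding solution_mapping_def using \<open>\<phi> ps = ps\<close> \<open>open U'\<close> V
    by (intro conjI exI[of _ U'] exI[of _ V]) (auto simp: U'_def)
  then show ?thesis by blast
qed

text \<open>The derivative \<open>D\<close> of \<open>Fhat P\<close> annihilates the displacement of
  the parameter and is bounded below on that of the solution. The remainder therefore controls
  \<open>norm (\<Phi> p - ps)\<close> alone.\<close>

lemma solution_mapping_quadratic:
  assumes \<Phi>: "solution_mapping P ps \<Phi>" and J: "(\<Phi> has_derivative (\<lambda>_. 0)) (at ps)"
  obtains K r where "r > 0"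
    "\<And>p. p \<in> ball ps r \<Longrightarrow> norm (\<Phi> p - ps) \<le> K * (norm (p - ps))\<^sup>2"
proof -
  let ?F = "\<lambda>z. Fhat P (fst z) (snd z)"
  obtain F' where F': "\<And>z. (?F has_derivative F' z) (at z)"
    by (rule Fhat_joint_derivative) (rule that)
  define D where "D = F' (ps, ps)"
  have D: "(?F has_derivative D) (at (ps, ps))" unfolding D_def by (rule F')
  have lin: "linear D" using D by (rule has_derivative_linear)
  have \<Phi>ps: "\<Phi> ps = ps" using \<Phi> by (simp add: solution_mapping_def)
  obtain U where U: "open U" "ps \<in> U" "\<And>p. p \<in> U \<Longrightarrow> Fhat P (\<Phi> p) p = 0"
    using \<Phi> unfolding solution_mapping_def local_kkt_def by blast
  \<comment> \<open>Differentiating the identity \<open>Fhat P (\<Phi> p) p = 0\<close> at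
    \<open>ps\<close>; the contribution through \<open>\<Phi>\<close> is zero.\<close>
  have D2: "D (0, v) = 0" for v
  proof -
    have "((\<lambda>p. ?F (\<Phi> p, p)) has_derivative (\<lambda>v. D (0, v))) (at ps)"
      by (rule has_derivative_compose[where f = "\<lambda>p. (\<Phi> p, p)"])
        (use D \<Phi>ps in \<open>auto intro!: has_derivative_Pair J\<close>)
    then have "((\<lambda>p. 0) has_derivative (\<lambda>v. D (0, v))) (at ps)"
      by (rule has_derivative_transform_within_open[OF _ U(1,2)]) (simp add: U(3))
    from has_derivative_unique[OF this has_derivative_const] show ?thesis by metis
  qed
  have "linear (\<lambda>v. D (v, 0))"
    by (rule linear_compose[of "\<lambda>v. (v, 0)" D, unfolded o_def]) (auto intro: linearI lin)
  moreover have "D (v, 0) = 0 \<Longrightarrow> v = 0" for v by (rule joint_derivative_inj[OF D])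
  ultimately obtain m where m: "m > 0" "\<And>v. m * norm v \<le> norm (D (v, 0))"
    using linear_inj_bounded_below_pos[of "\<lambda>v. D (v, 0)"] linear_injective_0 by blast
  obtain K e where e: "e > 0" "\<And>z. z \<in> ball (ps, ps) e \<Longrightarrow>
      norm (?F z - ?F (ps, ps) - D (z - (ps, ps))) \<le> K * (norm (z - (ps, ps)))\<^sup>2"
    using ck_quadratic_remainder[OF ck_Fhat D] by blast
  \<comment> \<open>A crude bound from the vanishing derivative with tolerance 1, which keeps the
    joint displacement comparable to \<open>norm (p - ps)\<close>.\<close>
  obtain d where d: "d > 0" "\<And>p. norm (p - ps) < d \<Longrightarrow> norm (\<Phi> p - ps) \<le> norm (p - ps)"
    using J \<Phi>ps unfolding has_derivative_at_alt by (metis diff_zero mult_1 zero_less_one)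
  obtain u where u: "u > 0" "ball ps u \<subseteq> U" using U open_contains_ball by blast
  \<comment> \<open>The squared joint displacement is at most twice
    \<open>(norm (p - ps))\<^sup>2\<close>, whence the factor 2; the joint displacement itself is at
    most \<open>2 * norm (p - ps)\<close>, whence \<open>e / 2\<close>. The absolute value covers a
    negative \<open>K\<close>.\<close>
  have "norm (\<Phi> p - ps) \<le> 2 * \<bar>K\<bar> / m * (norm (p - ps))\<^sup>2"
    if p: "p \<in> ball ps (min u (min d (e / 2)))" for p
  proof -
    let ?z = "(\<Phi> p, p)"
    have n: "norm (p - ps) < d" "norm (p - ps) < e / 2" "p \<in> U"
      using p u(2) by (auto simp: dist_norm norm_minus_commute subset_iff)
    note le = d(2)[OF n(1)]
    have sq: "(norm (?z - (ps, ps)))\<^sup>2 = (norm (\<Phi> p - ps))\<^sup>2 + (norm (p - ps))\<^sup>2"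
      by (simp add: norm_Pair)
    have "norm (?z - (ps, ps)) \<le> norm (\<Phi> p - ps) + norm (p - ps)"
      by (simp add: norm_Pair sqrt_sum_squares_le_sum)
    then have "dist ?z (ps, ps) < e" unfolding dist_norm using le n by linarith
    then have z: "?z \<in> ball (ps, ps) e" by (simp add: dist_commute)
    have "D (?z - (ps, ps)) = D (\<Phi> p - ps, 0) + D (0, p - ps)"
      by (simp add: linear_add[OF lin, symmetric])
    then have "m * norm (\<Phi> p - ps) \<le> norm (D (?z - (ps, ps)))"
      using m(2) by (simp add: D2)
    also have "\<dots> \<le> K * (norm (?z - (ps, ps)))\<^sup>2"
      using e(2)[OF z] U(3)[OF n(3)] U(3)[OF U(2)] \<Phi>ps by simp
    also have "\<dots> \<le> \<bar>K\<bar> * (2 * (norm (p - ps))\<^sup>2)"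
      unfolding sq using power_mono[OF le, of 2] by (intro mult_mono) auto
    finally show ?thesis using m(1) by (simp add: field_simps)
  qed
  moreover have "min u (min d (e / 2)) > 0" using u d e by simp
  ultimately show thesis using that by blast
qed

end

end

section \<open>Convergence\<close>

text \<open>The distance to \<open>a\<close> shrinks by the factor \<open>C\<close> at each step, so
  the ball is invariant and the errors are dominated by a geometric sequence.\<close>

lemma linear_convergence:
  fixes f :: "'a::real_normed_vector \<Rightarrow> 'a"
  assumes f: "\<And>p. p \<in> ball a r \<Longrightarrow> norm (f p - a) \<le> C * norm (p - a)" and C: "0 < C" "C < 1"
    and X: "X 0 \<in> ball a r" "\<And>q. X (Suc q) = f (X q)"
  shows "X q \<in> ball a r" "X \<longlonglongrightarrow> a"
proof -
  have *: "X q \<in> ball a r \<and> norm (X q - a) \<le> C ^ q * norm (X 0 - a)" for q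
  proof (induction q)
    case (Suc q)
    then have le: "norm (X (Suc q) - a) \<le> C * norm (X q - a)" using f X(2) by simp
    also have "\<dots> \<le> norm (X q - a)" using C by (simp add: mult_left_le_one_le)
    finally have "X (Suc q) \<in> ball a r" using Suc by (simp add: dist_norm norm_minus_commute)
    moreover have "C * norm (X q - a) \<le> C * (C ^ q * norm (X 0 - a))"
      using Suc C by (intro mult_left_mono) auto
    ultimately show ?case using le by simp
  qed (use X in simp)
  show "X q \<in> ball a r" using * by simp
  have "(\<lambda>q. C ^ q * norm (X 0 - a)) \<longlonglongrightarrow> 0"
    using C by (intro tendsto_mult_left_zero LIMSEQ_power_zero) auto
  then have "(\<lambda>q. X q - a) \<longlonglongrightarrow> 0"
    by (rule Lim_null_comparison[rotated]) (use * in simp)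
  then show "X \<longlonglongrightarrow> a" by (simp add: LIM_zero_iff)
qed

theorem theorem1:
  fixes P :: "('v::finite, 'n::finite, 'p::finite) nlp" and ps :: "real^'p"
  assumes "central_nlp P"
    and "assumption1 P ps"
    and "assumption2 P ps"
  shows "(\<exists>\<Phi>. solution_mapping P ps \<Phi>) \<and>
    (\<forall>\<Phi>. solution_mapping P ps \<Phi> \<longrightarrow>
      (\<exists>r>0. \<forall>a p0 pq.
        p0 \<in> ball ps r \<and> onorm ((*v) (jacobian \<Phi> (at ps))) < 1 \<and> sbdp_sequence a P \<Phi> p0 pq \<longrightarrow>
          pq \<longlonglongrightarrow> ps \<and>
          (\<exists>C. 0 < C \<and> C < 1 \<and> (\<forall>q\<ge>1. norm (pq q - ps) \<le> C * norm (pq (q - 1) - ps))) \<and>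
          (onorm ((*v) (jacobian \<Phi> (at ps))) = 0 \<longrightarrow>
            (\<exists>C'. \<forall>q\<ge>1. norm (pq q - ps) \<le> C' * (norm (pq (q - 1) - ps))\<^sup>2))))"
proof (intro conjI allI impI)
  have kkt: "central_kkt_point P ps" "strict_complementarity P ps"
    using assms(2) by (simp_all add: assumption1_def)
  show "\<exists>\<Phi>. solution_mapping P ps \<Phi>"
    by (rule solution_mapping_exists[OF assms(1) kkt assms(3)])
  fix \<Phi> assume \<Phi>: "solution_mapping P ps \<Phi>"
  define J where "J = (*v) (jacobian \<Phi> (at ps))"
  have \<Phi>ps: "\<Phi> ps = ps" using \<Phi> by (simp add: solution_mapping_def)
  have "\<Phi> differentiable (at ps)" using \<Phi> by (auto simp: solution_mapping_def)
  then have J: "(\<Phi> has_derivative J) (at ps)" by (simp add: J_def jacobian_works)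
  \<comment> \<open>The midpoint between \<open>onorm J\<close> and 1: the gap
    \<open>(1 - onorm J) / 2\<close> is left for the linearization error, and \<open>C\<close> is
    positive even when \<open>J\<close> vanishes.\<close>
  define C where "C = (1 + onorm J) / 2"
  have bl: "bounded_linear J" using J by (rule has_derivative_bounded_linear)
  have J0: "onorm J \<ge> 0" by (rule onorm_pos_le[OF bl])
  \<comment> \<open>The radius has to be fixed before the norm condition is assumed; if that
    condition fails, the radius 1 is an arbitrary choice.\<close>
  have "\<exists>r1>0. onorm J < 1 \<longrightarrow> (\<forall>p\<in>ball ps r1. norm (\<Phi> p - ps) \<le> C * norm (p - ps))"
  proof (cases "onorm J < 1")
    case True
    then have "(1 - onorm J) / 2 > 0" by simp
    then obtain r1 where r1: "r1 > 0" "\<And>p. norm (p - ps) < r1 \<Longrightarrow>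
        norm (\<Phi> p - ps - J (p - ps)) \<le> (1 - onorm J) / 2 * norm (p - ps)"
      using J \<Phi>ps unfolding has_derivative_at_alt by metis
    have "norm (\<Phi> p - ps) \<le> C * norm (p - ps)" if "p \<in> ball ps r1" for p
    proof -
      have "norm (\<Phi> p - ps) \<le> norm (J (p - ps)) + norm (\<Phi> p - ps - J (p - ps))"
        by (rule norm_triangle_sub)
      also have "\<dots> \<le> onorm J * norm (p - ps) + (1 - onorm J) / 2 * norm (p - ps)"
        using that by (intro add_mono onorm[OF bl] r1(2)) (simp add: dist_norm norm_minus_commute)
      also have "\<dots> = C * norm (p - ps)" by (simp add: C_def field_simps)
      finally show ?thesis .
    qed
    with r1(1) show ?thesis by blast
  qed (auto intro: exI[of _ 1])
  then obtain r1 where r1: "r1 > 0"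
    "\<And>p. onorm J < 1 \<Longrightarrow> p \<in> ball ps r1 \<Longrightarrow> norm (\<Phi> p - ps) \<le> C * norm (p - ps)" by blast
  \<comment> \<open>Likewise the radius for the quadratic estimate is chosen in advance, so that one
    \<open>r\<close> serves both claims.\<close>
  have "\<exists>r2>0. onorm J = 0 \<longrightarrow> (\<exists>K. \<forall>p\<in>ball ps r2. norm (\<Phi> p - ps) \<le> K * (norm (p - ps))\<^sup>2)"
  proof (cases "onorm J = 0")
    case True
    then have "J = (\<lambda>_. 0)" using onorm_eq_0[OF bl] by auto
    then show ?thesis
      using solution_mapping_quadratic[OF assms(1) kkt assms(3) \<Phi>] J by metis
  qed (auto intro: exI[of _ 1])
  then obtain r2 K where r2: "r2 > 0"
    "\<And>p. onorm J = 0 \<Longrightarrow> p \<in> ball ps r2 \<Longrightarrow> norm (\<Phi> p - ps) \<le> K * (norm (p - ps))\<^sup>2" by metis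
  have "pq \<longlonglongrightarrow> ps \<and>
      (\<exists>C. 0 < C \<and> C < 1 \<and> (\<forall>q\<ge>1. norm (pq q - ps) \<le> C * norm (pq (q - 1) - ps))) \<and>
      (onorm J = 0 \<longrightarrow> (\<exists>C'. \<forall>q\<ge>1. norm (pq q - ps) \<le> C' * (norm (pq (q - 1) - ps))\<^sup>2))"
    if p0: "p0 \<in> ball ps (min r1 r2)" and J1: "onorm J < 1" and seq: "sbdp_sequence a P \<Phi> p0 pq"
    for a p0 pq
  proof -
    have pq: "pq 0 \<in> ball ps (min r1 r2)" "\<And>q. pq (Suc q) = \<Phi> (pq q)"
      using p0 seq by (auto simp: sbdp_sequence_def)
    have C: "0 < C" "C < 1" using J1 J0 by (auto simp: C_def)
    have "norm (\<Phi> p - ps) \<le> C * norm (p - ps)" if "p \<in> ball ps (min r1 r2)" for p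
      using that J1 r1(2) by simp
    \<comment> \<open>Linear convergence on the smaller ball keeps every iterate where both one-step
      estimates hold.\<close>
    note conv = linear_convergence[OF this C pq]
    have step: "pq q = \<Phi> (pq (q - 1))" if "q \<ge> 1" for q
      using pq(2)[of "q - 1"] that by simp
    have "norm (pq q - ps) \<le> C * norm (pq (q - 1) - ps)" if "q \<ge> 1" for q
      using r1(2)[OF J1, of "pq (q - 1)"] conv(1)[of "q - 1"] step[OF that] by simp
    moreover have "norm (pq q - ps) \<le> K * (norm (pq (q - 1) - ps))\<^sup>2" if "onorm J = 0" "q \<ge> 1" for q
      using r2(2)[OF that(1), of "pq (q - 1)"] conv(1)[of "q - 1"] step[OF that(2)] by simp
    ultimately show ?thesis using conv(2) C by blast
  qed
  moreover have "min r1 r2 > 0" using r1 r2 by simp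
  ultimately show "\<exists>r>0. \<forall>a p0 pq.
        p0 \<in> ball ps r \<and> onorm ((*v) (jacobian \<Phi> (at ps))) < 1 \<and> sbdp_sequence a P \<Phi> p0 pq \<longrightarrow>
          pq \<longlonglongrightarrow> ps \<and>
          (\<exists>C. 0 < C \<and> C < 1 \<and> (\<forall>q\<ge>1. norm (pq q - ps) \<le> C * norm (pq (q - 1) - ps))) \<and>
          (onorm ((*v) (jacobian \<Phi> (at ps))) = 0 \<longrightarrow>
            (\<exists>C'. \<forall>q\<ge>1. norm (pq q - ps) \<le> C' * (norm (pq (q - 1) - ps))\<^sup>2))"
    unfolding J_def[symmetric] by (intro exI[of _ "min r1 r2"]) blast
qed

end
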